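(* Let $\mathcal H$ be a real Hilbert space. Let $f:\mathcal H\to\mathbb R$ be a differentiable function which is $\mu$-strongly convex for some $\mu>0$, and whose gradient is Lipschitz continuous on the bounded subsets of $\mathcal H$. Let $\overline x$ be the unique minimizer of $f$. Let $\phi:\mathcal H\to\mathbb R_+$ be a damping potential which is differentiable, and whose gradient is Lipschitz continuous on the bounded subsets of $\mathcal H$. Suppose that $\phi$ satisfies the following growth conditions: (i) (local) there exist positive constants $\alpha$ and $\rho$ such that $\langle\nabla\phi(u),u\rangle\ge\alpha\|u\|^2$ for all $u\in\mathcal H$ with $\|u\|\le\rho$; (ii) (global) there exist $p\ge1$ and $c>0$ such that $\phi(u)\ge c\|u\|^p$ for all $u\in\mathcal H$. Then, for any solution trajectory $x:[0,+\infty[\to\mathcal H$ of $$\ddot x(t)+\nabla\phi(\dot x(t))+\nabla f(x(t))=0,$$ the quantities $f(x(t))-f(\overline x)$, $\|x(t)-\overline x\|$ and $\|\dot x(t)\|$ converge to zero at an exponential rate as $t\to+\infty$.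
   Context: $f$ is $\mu$-strongly convex if $f-\frac{\mu}{2}\|\cdot\|^2$ is convex. A function $\phi:\mathcal H\to\mathbb R_+$ is a damping potential if: (i) $\phi$ is nonnegative, convex and continuous; (ii) $\phi(0)=0=\min_{\mathcal H}\phi$; (iii) for every $R>0$, $\sup_{\|u\|\le R}\|(\partial\phi)^0(u)\|<+\infty$, where $(\partial\phi)^0(u)$ is the element of minimal norm of the convex subdifferential $\partial\phi(u)$. A solution trajectory is a function $x\in\mathcal C^1([0,+\infty[;\mathcal H)$ such that, for all $T>0$, $\dot x$ is Lipschitz continuous on $(0,T)$ and $\ddot x\in L^\infty(0,T;\mathcal H)$, and the equation holds for almost every $t>0$. A nonnegative function $g$ on $[0,+\infty[$ converges to zero at an exponential rate if there exist constants $C,\kappa>0$ with $g(t)\le Ce^{-\kappa t}$ for all sufficiently large $t$. *)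

theory Defs
  imports "HOL-Analysis.Analysis"
begin

definition strongly_convex :: "real \<Rightarrow> ('a::real_inner \<Rightarrow> real) \<Rightarrow> bool"
  where "strongly_convex \<mu> f \<longleftrightarrow> convex_on UNIV (\<lambda>x. f x - \<mu> / 2 * (norm x)\<^sup>2)"

definition lipschitz_on_bounded :: "('a::metric_space \<Rightarrow> 'b::metric_space) \<Rightarrow> bool"
  where "lipschitz_on_bounded g \<longleftrightarrow> (\<forall>B. bounded B \<longrightarrow> (\<exists>L. L-lipschitz_on B g))"

definition subdifferential :: "('a::real_inner \<Rightarrow> real) \<Rightarrow> 'a \<Rightarrow> 'a set"
  where "subdifferential \<phi> u = {g. \<forall>v. \<phi> v \<ge> \<phi> u + inner g (v - u)}"

text \<open>In a Hilbert space the subdifferential of a continuous convex function is a nonempty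
  closed convex set, so the element selected here exists and is unique.\<close>

definition minimal_subgradient :: "('a::real_inner \<Rightarrow> real) \<Rightarrow> 'a \<Rightarrow> 'a"
  where "minimal_subgradient \<phi> u = arg_min norm (\<lambda>g. g \<in> subdifferential \<phi> u)"

definition damping_potential :: "('a::real_inner \<Rightarrow> real) \<Rightarrow> bool"
  where "damping_potential \<phi> \<longleftrightarrow>
    (\<forall>u. 0 \<le> \<phi> u) \<and> convex_on UNIV \<phi> \<and> continuous_on UNIV \<phi> \<and>
    \<phi> 0 = 0 \<and> is_arg_min \<phi> (\<lambda>_. True) 0 \<and>
    (\<forall>R>0. bdd_above ((\<lambda>u. norm (minimal_subgradient \<phi> u)) ` {u. norm u \<le> R}))"

text \<open>Trajectories live on the half-line, so derivatives are taken within it: one-sided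
  at 0, two-sided elsewhere, and independent of the values at negative times.\<close>

definition velocity :: "(real \<Rightarrow> 'a::real_normed_vector) \<Rightarrow> real \<Rightarrow> 'a"
  where "velocity x t = vector_derivative x (at t within {0..})"

definition acceleration :: "(real \<Rightarrow> 'a::real_normed_vector) \<Rightarrow> real \<Rightarrow> 'a"
  where "acceleration x t = vector_derivative (velocity x) (at t within {0..})"

text \<open>Membership in the Bochner space of essentially bounded functions. The values need not
  lie in a separable space, so strong measurability (approximation by simple functions)
  is spelled out instead of Borel measurability.\<close>

definition L_infinity_on :: "real set \<Rightarrow> (real \<Rightarrow> 'a::real_normed_vector) \<Rightarrow> bool"
  where "L_infinity_on S g \<longleftrightarrow>
    (\<exists>s. (\<forall>n. simple_function (lebesgue_on S) (s n)) \<and>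
         (AE t in lebesgue_on S. (\<lambda>n::nat. s n t) \<longlonglongrightarrow> g t)) \<and>
    (\<exists>C. AE t in lebesgue_on S. norm (g t) \<le> C)"

text \<open>Differentiability of the velocity is only required almost everywhere; it is stated
  explicitly because \<^const>\<open>vector_derivative\<close> is unspecified where no derivative exists.\<close>

definition solution_trajectory ::
    "('a::real_inner \<Rightarrow> 'a) \<Rightarrow> ('a \<Rightarrow> 'a) \<Rightarrow> (real \<Rightarrow> 'a) \<Rightarrow> bool"
  where "solution_trajectory grad_\<phi> grad_f x \<longleftrightarrow>
    x differentiable_on {0..} \<and> continuous_on {0..} (velocity x) \<and>
    (\<forall>T>0. (\<exists>L. L-lipschitz_on {0<..<T} (velocity x)) \<and>
           L_infinity_on {0<..<T} (acceleration x)) \<and>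
    (AE t in lebesgue. t > 0 \<longrightarrow>
       velocity x differentiable (at t within {0..}) \<and>
       acceleration x t + grad_\<phi> (velocity x t) + grad_f (x t) = 0)"

definition exponential_rate_to_zero :: "(real \<Rightarrow> real) \<Rightarrow> bool"
  where "exponential_rate_to_zero g \<longleftrightarrow>
    (\<forall>t\<ge>0. 0 \<le> g t) \<and>
    (\<exists>C>0. \<exists>\<kappa>>0. \<forall>\<^sub>F t in at_top. g t \<le> C * exp (- \<kappa> * t))"

end

theory Submission
  imports Defs
begin

text \<open>
Write \<open>v\<close> for the velocity and \<open>E = \<parallel>v\<parallel>\<^sup>2 / 2 + f(x) - f(xbar)\<close> for the mechanical energy. Along a
trajectory \<open>E' = - \<langle>\<nabla>\<phi>(v), v\<rangle> \<le> 0\<close>, so \<open>v\<close> stays in a ball of some radius \<open>R\<close>. On that ball the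
damping behaves like a linear one: the two growth conditions combine to
\<open>\<langle>\<nabla>\<phi>(u), u\<rangle> \<ge> \<beta> \<parallel>u\<parallel>\<^sup>2\<close> (\<open>damping_coercive_on_ball\<close>), and since \<open>\<nabla>\<phi>(0) = 0\<close> and \<open>\<nabla>\<phi>\<close> is
Lipschitz there, \<open>\<parallel>\<nabla>\<phi>(u)\<parallel> \<le> K \<parallel>u\<parallel>\<close>. The exponential decay of \<open>E\<close> then follows as for linearly
damped systems, from the Lyapunov function \<open>E + \<epsilon> \<langle>v, x - xbar\<rangle>\<close> with small \<open>\<epsilon>\<close>
(\<open>mechanical_energy_exponential_decay\<close>). Finally \<open>E\<close> dominates \<open>f(x) - f(xbar)\<close>, \<open>\<parallel>v\<parallel>\<^sup>2 / 2\<close> and,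
by strong convexity, \<open>\<mu> / 2 * \<parallel>x - xbar\<parallel>\<^sup>2\<close>.

These computations differentiate \<open>v\<close> at every time, whereas a solution trajectory satisfies the
equation only almost everywhere. The gap closes because \<open>v\<close> is locally Lipschitz and its almost
everywhere derivative agrees with a continuous function
(\<open>lipschitz_ae_derivative_continuous_imp_derivative\<close>). All estimates are made from time 1 on, which
avoids one-sided derivatives at 0 and does not affect rates at infinity.
\<close>

section \<open>Differentiable convex functions\<close>

lemma GDERIV_compose_curve:
  fixes f :: "'a::real_inner \<Rightarrow> real"
  assumes "GDERIV f (x t) :> g" and "(x has_vector_derivative v) (at t)"
  shows "((\<lambda>s. f (x s)) has_real_derivative inner v g) (at t)"
proof -
  have "((\<lambda>s. f (x s)) has_derivative (\<lambda>h. inner (h *\<^sub>R v) g)) (at t)"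
    using has_derivative_compose[of x "\<lambda>h. h *\<^sub>R v" t UNIV f "\<lambda>h. inner h g"] assms
    by (simp add: gderiv_def has_vector_derivative_def)
  moreover have "(\<lambda>h. inner (h *\<^sub>R v) g) = (*) (inner v g)"
    by (simp add: fun_eq_iff)
  ultimately show ?thesis
    by (simp add: has_field_derivative_def)
qed

text \<open>Restricting \<open>f\<close> to the line through \<open>u\<close> and \<open>w\<close> reduces this to the tangent inequality for
  convex functions of one real variable.\<close>

lemma convex_on_above_gradient_tangent:
  fixes f :: "'a::real_inner \<Rightarrow> real"
  assumes conv: "convex_on UNIV f" and grad: "GDERIV f u :> g"
  shows "f u + inner g (w - u) \<le> f w"
proof -
  define h where "h s = f (u + s *\<^sub>R (w - u))" for s :: real
  have "convex_on UNIV h"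
  proof (rule convex_onI)
    fix t a b :: real
    assume "0 < t" "t < 1"
    moreover have "u + ((1 - t) *\<^sub>R a + t *\<^sub>R b) *\<^sub>R (w - u)
        = (1 - t) *\<^sub>R (u + a *\<^sub>R (w - u)) + t *\<^sub>R (u + b *\<^sub>R (w - u))"
      by (simp add: algebra_simps)
    ultimately show "h ((1 - t) *\<^sub>R a + t *\<^sub>R b) \<le> (1 - t) * h a + t * h b"
      unfolding h_def using convex_onD[OF conv, of t] by auto
  qed simp
  moreover have "(h has_real_derivative inner (w - u) g) (at 0)"
    unfolding h_def
    by (rule GDERIV_compose_curve) (use grad in \<open>auto intro!: derivative_eq_intros\<close>)
  ultimately have "inner (w - u) g * (1 - 0) \<le> h 1 - h 0"
    by (intro convex_on_imp_above_tangent[where A = UNIV]) auto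
  then show ?thesis
    by (simp add: h_def inner_commute)
qed

lemma strongly_convex_above_gradient_tangent:
  fixes f :: "'a::real_inner \<Rightarrow> real"
  assumes conv: "strongly_convex \<mu> f" and grad: "GDERIV f u :> g"
  shows "f u + inner g (w - u) + \<mu> / 2 * (norm (w - u))\<^sup>2 \<le> f w"
proof -
  have "GDERIV (\<lambda>x. f x - \<mu> / 2 * (norm x)\<^sup>2) u :> g - \<mu> *\<^sub>R u"
    using grad unfolding gderiv_def power2_norm_eq_inner
    by (auto intro!: derivative_eq_intros simp: algebra_simps inner_commute)
  from convex_on_above_gradient_tangent[OF conv[unfolded strongly_convex_def] this, of w]
  show ?thesis
    by (simp add: power2_norm_eq_inner algebra_simps inner_commute)
qed

lemma GDERIV_at_minimum:
  fixes f :: "'a::real_inner \<Rightarrow> real"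
  assumes "is_arg_min f (\<lambda>_. True) u" and "GDERIV f u :> g"
  shows "g = 0"
proof -
  have "((\<lambda>s. f (u + s *\<^sub>R g)) has_real_derivative inner g g) (at 0)"
    by (rule GDERIV_compose_curve) (use assms(2) in \<open>auto intro!: derivative_eq_intros\<close>)
  then have "inner g g = 0"
    using assms(1) by (rule_tac DERIV_local_min[of _ _ _ 1]) (auto simp: is_arg_min_linorder)
  then show ?thesis
    by simp
qed

section \<open>Lipschitz curves with a derivative almost everywhere\<close>

text \<open>A Lipschitz map sends null sets to null sets, so a height \<open>y\<close> not attained on the exceptional
  set could be chosen between \<open>g a\<close> and \<open>g b\<close> if \<open>g a < g b\<close>. At the last time where \<open>g\<close> takes the
  value \<open>y\<close>, the derivative would exist and could not be negative.\<close>

lemma lipschitz_ae_neg_derivative_imp_le: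
  fixes g :: "real \<Rightarrow> real"
  assumes "a \<le> b" and lip: "L-lipschitz_on {a..b} g" and N: "negligible N"
    and der: "\<And>t. a < t \<Longrightarrow> t < b \<Longrightarrow> t \<notin> N \<Longrightarrow> \<exists>d<0. (g has_real_derivative d) (at t)"
  shows "g b \<le> g a"
proof (rule ccontr)
  assume "\<not> g b \<le> g a"
  then have less: "g a < g b" by simp
  have cont: "continuous_on {a..b} g"
    using lip by (rule lipschitz_on_continuous_on)
  have "negligible (g ` (N \<inter> {a..b}))"
  proof (rule negligible_locally_Lipschitz_image)
    show "\<exists>T B. open T \<and> t \<in> T \<and> (\<forall>s\<in>N \<inter> {a..b} \<inter> T. norm (g s - g t) \<le> B * norm (s - t))"
      if "t \<in> N \<inter> {a..b}" for t
      using lipschitz_onD[OF lip] that by (intro exI[of _ UNIV] exI[of _ L]) (auto simp: dist_norm)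
  qed (use N in \<open>auto intro: negligible_Int\<close>)
  moreover have "\<not> negligible {g a<..<g b}"
    using less negligible_interval(2)[of "g a" "g b"] by (simp add: box_real)
  ultimately obtain y where y: "g a < y" "y < g b" "y \<notin> g ` (N \<inter> {a..b})"
    using negligible_subset by (metis greaterThanLessThan_iff subsetI)
  define S where "S = {t \<in> {a..b}. g t \<le> y}"
  have "compact S"
    unfolding S_def
    using continuous_closed_preimage[OF cont closed_atLeastAtMost closed_atMost[of y]]
    by (auto simp: compact_eq_bounded_closed vimage_def Int_def intro: bounded_subset[of "{a..b}"])
  moreover have "a \<in> S"
    using y assms(1) by (auto simp: S_def)
  ultimately obtain s where s: "s \<in> S" "\<And>t. t \<in> S \<Longrightarrow> t \<le> s"
    using compact_attains_sup by (metis empty_iff)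
  then have s_ab: "a \<le> s" "s < b" "g s \<le> y"
    using y by (auto simp: S_def less_le)
  obtain r where r: "s \<le> r" "r \<le> b" "g r = y"
    using IVT'[of g s y b] s_ab y continuous_on_subset[OF cont, of "{s..b}"] by auto
  then have "g s = y"
    using s(2)[of r] s_ab by (auto simp: S_def)
  then have "s \<notin> N" "a < s"
    using y s_ab by (auto simp: less_le)
  then obtain d where "d < 0" "(g has_real_derivative d) (at s)"
    using der s_ab by blast
  then obtain e where e: "e > 0" "\<And>h. h > 0 \<Longrightarrow> h < e \<Longrightarrow> g (s + h) < g s"
    using DERIV_neg_dec_right by blast
  define h where "h = min (e / 2) (b - s)"
  have "s + h \<in> S" "h > 0"
    using e(1) e(2)[of h] s_ab unfolding S_def h_def by (auto simp: min_def split: if_splits)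
  then show False
    using s(2)[of "s + h"] by simp
qed

text \<open>The scalar comparison applies to the motion relative to the uniform motion with velocity \<open>w\<close>,
  projected onto the direction of its own total increment \<open>z\<close>: the projection grows at a rate of
  at most \<open>\<epsilon> * norm z\<close>, while its total growth is \<open>(norm z)\<^sup>2\<close>.\<close>

lemma lipschitz_ae_derivative_near_imp_increment_near:
  fixes v :: "real \<Rightarrow> 'a::real_inner"
  assumes "a \<le> b" and "0 \<le> \<epsilon>" and lip: "L-lipschitz_on {a..b} v" and N: "negligible N"
    and der: "\<And>t. a < t \<Longrightarrow> t < b \<Longrightarrow> t \<notin> N \<Longrightarrow>
      \<exists>d. (v has_vector_derivative d) (at t) \<and> norm (d - w) < \<epsilon>"
  shows "norm (v b - v a - (b - a) *\<^sub>R w) \<le> \<epsilon> * (b - a)"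
proof -
  define z where "z = v b - v a - (b - a) *\<^sub>R w"
  define g where "g t = inner (v t - t *\<^sub>R w) z - \<epsilon> * norm z * t" for t
  show ?thesis
  proof (cases "z = 0")
    case True
    then show ?thesis
      using assms(1,2) by (simp add: z_def)
  next
    case False
    have "g b \<le> g a"
    proof (rule lipschitz_ae_neg_derivative_imp_le[OF assms(1) _ N])
      have L: "0 \<le> L"
        using lip by (rule lipschitz_on_nonneg)
      show "((L + norm w) * norm z + \<bar>\<epsilon>\<bar> * norm z)-lipschitz_on {a..b} g"
      proof (rule lipschitz_onI)
        fix s t assume st: "s \<in> {a..b}" "t \<in> {a..b}"
        have "norm ((v s - v t) - (s - t) *\<^sub>R w) \<le> norm (v s - v t) + norm ((s - t) *\<^sub>R w)"
          by (rule norm_triangle_ineq4)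
        also have "\<dots> \<le> (L + norm w) * \<bar>s - t\<bar>"
          using lipschitz_onD[OF lip st]
          by (simp add: dist_norm distrib_right mult.commute[of "norm w"])
        finally have "norm ((v s - v t) - (s - t) *\<^sub>R w) * norm z \<le> (L + norm w) * \<bar>s - t\<bar> * norm z"
          by (rule mult_right_mono) simp
        then have 1: "\<bar>inner ((v s - v t) - (s - t) *\<^sub>R w) z\<bar> \<le> (L + norm w) * \<bar>s - t\<bar> * norm z"
          using Cauchy_Schwarz_ineq2 order_trans by blast
        have 2: "g s - g t = inner ((v s - v t) - (s - t) *\<^sub>R w) z - \<epsilon> * norm z * (s - t)"
          by (simp add: g_def algebra_simps)
        have "\<bar>\<epsilon> * norm z * (s - t)\<bar> = \<bar>\<epsilon>\<bar> * norm z * \<bar>s - t\<bar>"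
          by (simp add: abs_mult)
        then show "dist (g s) (g t) \<le> ((L + norm w) * norm z + \<bar>\<epsilon>\<bar> * norm z) * dist s t"
          unfolding dist_real_def 2
          using 1 abs_triangle_ineq4[of "inner ((v s - v t) - (s - t) *\<^sub>R w) z"
              "\<epsilon> * norm z * (s - t)"]
          by (simp add: distrib_left distrib_right mult_ac)
      qed (use L in simp)
      fix t assume t: "a < t" "t < b" "t \<notin> N"
      then obtain d where d: "(v has_vector_derivative d) (at t)" "norm (d - w) < \<epsilon>"
        using der by blast
      have "((\<lambda>t. v t - t *\<^sub>R w) has_vector_derivative d - w) (at t)"
        using d(1) by (auto intro!: derivative_eq_intros)
      then have "((\<lambda>t. inner (v t - t *\<^sub>R w) z) has_real_derivative inner (d - w) z) (at t)"
        unfolding has_real_derivative_iff_has_vector_derivative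
        by (rule bounded_linear.has_vector_derivative[OF bounded_linear_inner_left])
      then have "(g has_real_derivative inner (d - w) z - \<epsilon> * norm z) (at t)"
        unfolding g_def by (auto intro!: derivative_eq_intros)
      moreover have "inner (d - w) z \<le> norm (d - w) * norm z"
        by (rule norm_cauchy_schwarz)
      moreover have "norm (d - w) * norm z < \<epsilon> * norm z"
        using d(2) False by simp
      ultimately show "\<exists>d<0. (g has_real_derivative d) (at t)"
        by (intro exI[of _ "inner (d - w) z - \<epsilon> * norm z"]) auto
    qed
    moreover have "inner z z = inner (v b - b *\<^sub>R w) z - inner (v a - a *\<^sub>R w) z"
      unfolding inner_diff_left[symmetric] by (simp add: z_def algebra_simps)
    ultimately have "norm z * norm z \<le> (\<epsilon> * (b - a)) * norm z"
      by (simp add: g_def algebra_simps flip: power2_norm_eq_inner power2_eq_square)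
    then show ?thesis
      using False by (simp add: z_def)
  qed
qed

text \<open>Near \<open>t\<close> the continuous function \<open>acc\<close> stays close to \<open>acc t\<close>, so the increment estimate
  with \<open>w = acc t\<close> is exactly differentiability of \<open>v\<close> at \<open>t\<close>, whether or not \<open>t\<close> lies in the
  exceptional set.\<close>

lemma lipschitz_ae_derivative_continuous_imp_derivative:
  fixes v acc :: "real \<Rightarrow> 'a::real_inner"
  assumes lip: "L-lipschitz_on {a<..<b} v" and N: "negligible N"
    and der: "\<And>t. a < t \<Longrightarrow> t < b \<Longrightarrow> t \<notin> N \<Longrightarrow> (v has_vector_derivative acc t) (at t)"
    and cont: "continuous_on {a<..<b} acc" and t: "a < t" "t < b"
  shows "(v has_vector_derivative acc t) (at t)"
  unfolding has_vector_derivative_def has_derivative_at_alt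
proof (intro conjI allI impI bounded_linear_scaleR_left)
  fix e :: real assume e: "e > 0"
  have "isCont acc t"
    using cont t by (simp add: continuous_on_eq_continuous_at)
  then obtain d where d: "d > 0" "\<And>s. dist s t < d \<Longrightarrow> dist (acc s) (acc t) < e"
    using e unfolding continuous_at_eps_delta by metis
  define \<delta> where "\<delta> = min d (min (t - a) (b - t))"
  have increment: "norm (v r - v s - (r - s) *\<^sub>R acc t) \<le> e * (r - s)"
    if "s \<le> r" "t - \<delta> < s" "r < t + \<delta>" for s r
  proof (rule lipschitz_ae_derivative_near_imp_increment_near[OF that(1) _ _ N])
    show "L-lipschitz_on {s..r} v"
      using that by (intro lipschitz_on_subset[OF lip]) (auto simp: \<delta>_def)
    show "\<exists>d. (v has_vector_derivative d) (at \<tau>) \<and> norm (d - acc t) < e"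
      if "s < \<tau>" "\<tau> < r" "\<tau> \<notin> N" for \<tau>
      using that \<open>t - \<delta> < s\<close> \<open>r < t + \<delta>\<close> d(2)[of \<tau>]
      by (intro exI[of _ "acc \<tau>"] conjI der) (auto simp: \<delta>_def dist_norm)
  qed (use e in simp)
  have "norm (v s - v t - (s - t) *\<^sub>R acc t) \<le> e * norm (s - t)" if "norm (s - t) < \<delta>" for s
  proof (cases "t \<le> s")
    case True
    then show ?thesis using increment[of t s] that by auto
  next
    case False
    have "v s - v t - (s - t) *\<^sub>R acc t = - (v t - v s - (t - s) *\<^sub>R acc t)"
      by (simp add: algebra_simps)
    then have "norm (v s - v t - (s - t) *\<^sub>R acc t) = norm (v t - v s - (t - s) *\<^sub>R acc t)"
      by (simp only: norm_minus_cancel)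
    also have "\<dots> \<le> e * (t - s)"
      using that False by (intro increment) auto
    finally show ?thesis
      using False by simp
  qed
  moreover have "\<delta> > 0"
    using d t by (simp add: \<delta>_def)
  ultimately show "\<exists>d>0. \<forall>s. norm (s - t) < d \<longrightarrow>
      norm (v s - v t - (s - t) *\<^sub>R acc t) \<le> e * norm (s - t)"
    by blast
qed

section \<open>Solution trajectories are classical solutions\<close>

lemma lipschitz_on_bounded_imp_continuous:
  fixes g :: "'a::real_normed_vector \<Rightarrow> 'b::metric_space"
  assumes "lipschitz_on_bounded g"
  shows "continuous_on UNIV g"
proof -
  have "isCont g u" for u
  proof -
    obtain L where "L-lipschitz_on (ball u 1) g"
      using assms bounded_ball unfolding lipschitz_on_bounded_def by blast
    then have "continuous_on (ball u 1) g"
      by (rule lipschitz_on_continuous_on)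
    then show ?thesis
      by (simp add: continuous_on_eq_continuous_at)
  qed
  then show ?thesis
    by (simp add: continuous_at_imp_continuous_on)
qed

lemma solution_trajectory_has_velocity:
  fixes x :: "real \<Rightarrow> 'a::real_inner"
  assumes "solution_trajectory grad_\<phi> grad_f x" and "t > 0"
  shows "(x has_vector_derivative velocity x t) (at t)"
proof -
  have "x differentiable (at t within {0..})"
    using assms by (auto simp: solution_trajectory_def differentiable_on_def)
  then show ?thesis
    using \<open>t > 0\<close> at_within_interior[of t "{0..}"]
    by (simp add: velocity_def vector_derivative_works interior_real_atLeast)
qed

text \<open>The equation equates the acceleration almost everywhere with a continuous function of time,
  and the velocity is locally Lipschitz; hence the velocity is \<open>C\<^sup>1\<close> and the equation holds at
  every positive time.\<close>

lemma solution_trajectory_classical: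
  fixes x :: "real \<Rightarrow> 'a::real_inner"
  assumes sol: "solution_trajectory grad_\<phi> grad_f x"
    and cont_\<phi>: "continuous_on UNIV grad_\<phi>" and cont_f: "continuous_on UNIV grad_f"
    and t: "t > 0"
  shows "(velocity x has_vector_derivative - grad_\<phi> (velocity x t) - grad_f (x t)) (at t)"
proof -
  define acc where "acc t = - grad_\<phi> (velocity x t) - grad_f (x t)" for t
  obtain N where N: "negligible N" and ae: "\<And>s. s \<notin> N \<Longrightarrow> s > 0 \<Longrightarrow>
      velocity x differentiable (at s within {0..}) \<and>
      acceleration x s + grad_\<phi> (velocity x s) + grad_f (x s) = 0"
    using sol unfolding solution_trajectory_def eventually_ae_filter_negligible by blast
  have der: "(velocity x has_vector_derivative acc s) (at s)" if "0 < s" "s < t + 1" "s \<notin> N" for s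
  proof -
    have "(velocity x has_vector_derivative acceleration x s) (at s)"
      using ae[OF \<open>s \<notin> N\<close> \<open>0 < s\<close>] at_within_interior[of s "{0..}"] \<open>0 < s\<close>
      by (simp add: acceleration_def vector_derivative_works interior_real_atLeast)
    moreover have "acceleration x s = acc s"
      using ae[OF \<open>s \<notin> N\<close> \<open>0 < s\<close>] by (simp add: acc_def algebra_simps eq_neg_iff_add_eq_0)
    ultimately show ?thesis by simp
  qed
  have "continuous_on {0..} x" "continuous_on {0..} (velocity x)"
    using sol by (auto simp: solution_trajectory_def intro: differentiable_imp_continuous_on)
  then have "continuous_on {0<..<t + 1} x" "continuous_on {0<..<t + 1} (velocity x)"
    by (auto elim: continuous_on_subset)
  then have "continuous_on {0<..<t + 1} acc"
    unfolding acc_def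
    by (intro continuous_intros continuous_on_compose2[OF cont_\<phi>] continuous_on_compose2[OF cont_f])
      auto
  moreover obtain L where "L-lipschitz_on {0<..<t + 1} (velocity x)"
    using sol t unfolding solution_trajectory_def by (metis add_pos_pos zero_less_one)
  ultimately show ?thesis
    using lipschitz_ae_derivative_continuous_imp_derivative[of L 0 "t + 1" "velocity x" N acc t]
      N der t unfolding acc_def[of t, symmetric] by simp
qed

section \<open>Coercivity of the damping\<close>

text \<open>On the annulus between radius \<open>\<rho>\<close> and radius \<open>R\<close>, convexity and the global growth bound
  give \<open>\<langle>\<nabla>\<phi>(u), u\<rangle> \<ge> \<phi>(u) \<ge> c \<rho>\<^sup>p\<close>, and this positive constant dominates a multiple of
  \<open>\<parallel>u\<parallel>\<^sup>2\<close> there. Inside the ball of radius \<open>\<rho>\<close> the local growth condition applies.\<close>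

lemma damping_coercive_on_ball:
  fixes \<phi> :: "'a::real_inner \<Rightarrow> real"
  assumes conv: "convex_on UNIV \<phi>" and "\<phi> 0 = 0" and grad: "\<And>u. GDERIV \<phi> u :> grad_\<phi> u"
    and "\<alpha> > 0" "\<rho> > 0" and loc: "\<And>u. norm u \<le> \<rho> \<Longrightarrow> inner (grad_\<phi> u) u \<ge> \<alpha> * (norm u)\<^sup>2"
    and "p \<ge> 0" "c > 0" and glob: "\<And>u. \<phi> u \<ge> c * norm u powr p"
  shows "\<exists>\<beta>>0. \<forall>u. norm u \<le> R \<longrightarrow> \<beta> * (norm u)\<^sup>2 \<le> inner (grad_\<phi> u) u"
proof -
  define R' where "R' = max R \<rho>"
  have R': "R' > 0" using \<open>\<rho> > 0\<close> by (simp add: R'_def)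
  define \<beta> where "\<beta> = min \<alpha> (c * \<rho> powr p / R'\<^sup>2)"
  have "\<beta> > 0"
    using assms R' by (simp add: \<beta>_def)
  moreover have "\<beta> * (norm u)\<^sup>2 \<le> inner (grad_\<phi> u) u" if "norm u \<le> R" for u
  proof (cases "norm u \<le> \<rho>")
    case True
    have "\<beta> * (norm u)\<^sup>2 \<le> \<alpha> * (norm u)\<^sup>2"
      by (intro mult_right_mono) (auto simp: \<beta>_def)
    then show ?thesis
      using loc[OF True] by simp
  next
    case False
    have "\<beta> * (norm u)\<^sup>2 \<le> (c * \<rho> powr p / R'\<^sup>2) * R'\<^sup>2"
      using that assms by (intro mult_mono power_mono) (auto simp: \<beta>_def R'_def)
    also have "\<dots> = c * \<rho> powr p"
      using R' by simp
    also have "\<dots> \<le> c * norm u powr p"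
      using False assms by (intro mult_left_mono powr_mono2) auto
    also have "\<dots> \<le> \<phi> u"
      by (rule glob)
    also have "\<dots> \<le> inner (grad_\<phi> u) u"
      using convex_on_above_gradient_tangent[OF conv grad[of u], of 0] \<open>\<phi> 0 = 0\<close> by simp
    finally show ?thesis .
  qed
  ultimately show ?thesis by blast
qed

lemma lipschitz_on_bounded_zero_imp_linear_growth:
  fixes g :: "'a::real_normed_vector \<Rightarrow> 'b::real_normed_vector"
  assumes "lipschitz_on_bounded g" and "g 0 = 0"
  shows "\<exists>K. \<forall>u. norm u \<le> R \<longrightarrow> norm (g u) \<le> K * norm u"
proof -
  obtain L where L: "L-lipschitz_on (cball 0 (max R 0)) g"
    using assms(1) bounded_cball unfolding lipschitz_on_bounded_def by blast
  have "norm (g u) \<le> L * norm u" if "norm u \<le> R" for u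
    using lipschitz_onD[OF L, of u 0] that assms(2) by simp
  then show ?thesis
    by blast
qed

section \<open>Energy estimates\<close>

lemma exponential_decay_of_differential_inequality:
  fixes H H' :: "real \<Rightarrow> real"
  assumes der: "\<And>t. t \<ge> t0 \<Longrightarrow> (H has_real_derivative H' t) (at t)"
    and le: "\<And>t. t \<ge> t0 \<Longrightarrow> H' t \<le> - \<kappa> * H t" and "t \<ge> t0"
  shows "H t \<le> H t0 * exp (- \<kappa> * (t - t0))"
proof -
  have "H t * exp (\<kappa> * (t - t0)) \<le> H t0 * exp (\<kappa> * (t0 - t0))"
  proof (rule DERIV_nonpos_imp_nonincreasing[OF \<open>t \<ge> t0\<close>])
    fix s assume s: "t0 \<le> s"
    have "((\<lambda>s. H s * exp (\<kappa> * (s - t0))) has_real_derivative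
        (H' s + \<kappa> * H s) * exp (\<kappa> * (s - t0))) (at s)"
      by (auto intro!: derivative_eq_intros der s simp: algebra_simps)
    moreover have "(H' s + \<kappa> * H s) * exp (\<kappa> * (s - t0)) \<le> 0"
      using le[OF s] by (intro mult_nonpos_nonneg) auto
    ultimately show "\<exists>d. ((\<lambda>s. H s * exp (\<kappa> * (s - t0))) has_real_derivative d) (at s) \<and> d \<le> 0"
      by blast
  qed
  moreover have "exp (- \<kappa> * (t - t0)) = inverse (exp (\<kappa> * (t - t0)))"
    by (simp flip: exp_minus)
  ultimately show ?thesis
    by (simp add: divide_inverse[symmetric] pos_le_divide_eq)
qed

lemma exponential_rate_to_zero_if_square:
  assumes "\<And>t. 0 \<le> g t" and "D \<ge> 0" "\<kappa> > 0"
    and "\<And>t. t \<ge> t0 \<Longrightarrow> (g t)\<^sup>2 \<le> D * exp (- \<kappa> * t)"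
  shows "exponential_rate_to_zero g"
proof -
  have "g t \<le> sqrt (D + 1) * exp (- (\<kappa> / 2) * t)" if "t \<ge> t0" for t
  proof (rule power2_le_imp_le)
    have "(g t)\<^sup>2 \<le> (D + 1) * exp (- \<kappa> * t)"
      using assms(4)[OF that] by (rule order_trans) (simp add: algebra_simps)
    also have "\<dots> = (sqrt (D + 1) * exp (- (\<kappa> / 2) * t))\<^sup>2"
      using \<open>D \<ge> 0\<close> by (simp add: power_mult_distrib flip: exp_double)
    finally show "(g t)\<^sup>2 \<le> (sqrt (D + 1) * exp (- (\<kappa> / 2) * t))\<^sup>2" .
  qed (use \<open>D \<ge> 0\<close> in simp)
  then have "\<forall>\<^sub>F t in at_top. g t \<le> sqrt (D + 1) * exp (- (\<kappa> / 2) * t)"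
    using eventually_at_top_linorder by blast
  moreover have "sqrt (D + 1) > 0" "\<kappa> / 2 > 0"
    using assms by auto
  ultimately show ?thesis
    using assms(1) unfolding exponential_rate_to_zero_def by blast
qed

definition mechanical_energy ::
    "('a::real_inner \<Rightarrow> real) \<Rightarrow> 'a \<Rightarrow> (real \<Rightarrow> 'a) \<Rightarrow> (real \<Rightarrow> 'a) \<Rightarrow> real \<Rightarrow> real"
  where "mechanical_energy f xbar x v t = (norm (v t))\<^sup>2 / 2 + (f (x t) - f xbar)"

lemma mechanical_energy_has_derivative:
  fixes x v :: "real \<Rightarrow> 'a::real_inner"
  assumes "(x has_vector_derivative v t) (at t)"
    and v: "(v has_vector_derivative - d - g) (at t)" and "GDERIV f (x t) :> g"
  shows "(mechanical_energy f xbar x v has_real_derivative - inner d (v t)) (at t)"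
proof -
  have "((\<lambda>s. inner (v s) (v s)) has_real_derivative
      inner (v t) (- d - g) + inner (- d - g) (v t)) (at t)"
    unfolding has_real_derivative_iff_has_vector_derivative
    using bounded_bilinear.has_vector_derivative[OF bounded_bilinear_inner v v] by simp
  then show ?thesis
    unfolding mechanical_energy_def power2_norm_eq_inner
    using GDERIV_compose_curve[OF assms(3,1)]
    by (auto intro!: derivative_eq_intros
        simp: inner_diff_left inner_diff_right inner_commute field_simps)
qed

text \<open>The energy alone is only guaranteed to dissipate at the rate \<open>\<beta> \<parallel>v\<parallel>\<^sup>2\<close>, which gives no
  control when the velocity vanishes away from equilibrium. Adding the cross term
  \<open>\<epsilon> \<langle>v, x - xbar\<rangle>\<close> produces the missing term: strong convexity turns \<open>- \<epsilon> \<langle>\<nabla>f(x), x - xbar\<rangle>\<close> into \<open>- \<epsilon> (f(x) - f(xbar))\<close> and a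
  multiple of \<open>- \<parallel>x - xbar\<parallel>\<^sup>2\<close>, and the latter absorbs the damping force that acts along
  \<open>x - xbar\<close>. For small \<open>\<epsilon>\<close> the modified energy \<open>H\<close> lies between \<open>E / 2\<close> and \<open>3 E / 2\<close>
  and satisfies \<open>H' \<le> - \<epsilon> E\<close>.\<close>

lemma mechanical_energy_exponential_decay:
  fixes f :: "'a::real_inner \<Rightarrow> real" and x v :: "real \<Rightarrow> 'a"
  assumes grad: "\<And>y. GDERIV f y :> grad_f y" and "\<mu> > 0" and sc: "strongly_convex \<mu> f"
    and "grad_f xbar = 0" and "\<beta> > 0"
    and x: "\<And>t. t \<ge> t0 \<Longrightarrow> (x has_vector_derivative v t) (at t)"
    and v: "\<And>t. t \<ge> t0 \<Longrightarrow> (v has_vector_derivative - d t - grad_f (x t)) (at t)"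
    and coer: "\<And>t. t \<ge> t0 \<Longrightarrow> \<beta> * (norm (v t))\<^sup>2 \<le> inner (d t) (v t)"
    and growth: "\<And>t. t \<ge> t0 \<Longrightarrow> norm (d t) \<le> K * norm (v t)"
  shows "\<exists>C>0. \<exists>\<kappa>>0. \<forall>t\<ge>t0. mechanical_energy f xbar x v t \<le> C * exp (- \<kappa> * t)"
proof -
  define E where "E = mechanical_energy f xbar x v"
  define q where "q = 3 / 2 + K\<^sup>2 / (2 * \<mu>)"
  \<comment> \<open>The first bound keeps the dissipation in control of the cross term's derivative,
    the second keeps the modified energy comparable to the energy.\<close>
  define \<epsilon> where "\<epsilon> = min (\<beta> / q) (1 / (2 * (1 + 1 / \<mu>)))"
  define H where "H t = E t + \<epsilon> * inner (v t) (x t - xbar)" for t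
  define H' where "H' t = - inner (d t) (v t)
      + \<epsilon> * (inner (- d t - grad_f (x t)) (x t - xbar) + inner (v t) (v t))" for t
  have q: "q > 0"
    using \<open>\<mu> > 0\<close> by (simp add: q_def add_pos_nonneg)
  have m: "1 + 1 / \<mu> > 0"
    using \<open>\<mu> > 0\<close> by (simp add: add_pos_pos)
  have \<epsilon>: "\<epsilon> > 0"
    using q m \<open>\<beta> > 0\<close> by (simp add: \<epsilon>_def)
  have \<epsilon>1: "\<epsilon> * q \<le> \<beta>"
    using q by (simp add: \<epsilon>_def min_def field_simps) 
  have \<epsilon>2: "\<epsilon> * (1 + 1 / \<mu>) \<le> 1 / 2"
  proof -
    have "\<epsilon> \<le> 1 / (2 * (1 + 1 / \<mu>))" by (simp add: \<epsilon>_def)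
    then have "\<epsilon> * (1 + 1 / \<mu>) \<le> 1 / (2 * (1 + 1 / \<mu>)) * (1 + 1 / \<mu>)"
      using m by (intro mult_right_mono) auto
    also have "\<dots> = 1 / 2"
      using m by (simp only: times_divide_eq_left divide_eq_eq) simp
    finally show ?thesis .
  qed
  have gap: "\<mu> / 2 * (norm (x t - xbar))\<^sup>2 \<le> f (x t) - f xbar" for t
    using strongly_convex_above_gradient_tangent[OF sc grad, of xbar "x t"] \<open>grad_f xbar = 0\<close>
    by simp
  have H_near_E: "\<bar>H t - E t\<bar> \<le> E t / 2" for t
  proof -
    have "\<bar>inner (v t) (x t - xbar)\<bar> \<le> norm (v t) * norm (x t - xbar)"
      by (rule Cauchy_Schwarz_ineq2)
    also have "\<dots> \<le> (norm (v t))\<^sup>2 / 2 + (norm (x t - xbar))\<^sup>2 / 2"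
      using sum_squares_bound[of "norm (v t)" "norm (x t - xbar)"] by simp
    also have "(norm (x t - xbar))\<^sup>2 / 2 \<le> (f (x t) - f xbar) / \<mu>"
      using gap[of t] \<open>\<mu> > 0\<close> by (simp add: field_simps)
    also have "(norm (v t))\<^sup>2 / 2 + (f (x t) - f xbar) / \<mu> \<le> E t + E t / \<mu>"
    proof -
      have "0 \<le> \<mu> / 2 * (norm (x t - xbar))\<^sup>2" using \<open>\<mu> > 0\<close> by simp
      then have "0 \<le> f (x t) - f xbar" using gap[of t] by linarith
      moreover have "(f (x t) - f xbar) / \<mu> \<le> E t / \<mu>"
        using \<open>\<mu> > 0\<close> by (intro divide_right_mono) (auto simp: E_def mechanical_energy_def)
      ultimately show ?thesis
        by (simp add: E_def mechanical_energy_def)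
    qed
    finally have "\<epsilon> * \<bar>inner (v t) (x t - xbar)\<bar> \<le> \<epsilon> * (E t + E t / \<mu>)"
      using \<epsilon> by (intro mult_left_mono) auto
    also have "\<dots> = \<epsilon> * (1 + 1 / \<mu>) * E t"
      by (simp add: algebra_simps)
    also have "\<dots> \<le> 1 / 2 * E t"
    proof (rule mult_right_mono[OF \<epsilon>2])
      have "0 \<le> \<mu> / 2 * (norm (x t - xbar))\<^sup>2" using \<open>\<mu> > 0\<close> by simp
      then show "0 \<le> E t"
        using gap[of t] unfolding E_def mechanical_energy_def
        by (intro add_nonneg_nonneg) auto
    qed
    finally show ?thesis
      using \<epsilon> by (simp add: H_def abs_mult)
  qed
  have dissipation: "H' t \<le> - \<epsilon> * E t" if t: "t \<ge> t0" for t
  proof -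
    define V where "V = norm (v t)"
    define Y where "Y = norm (x t - xbar)"
    have "- inner (d t) (x t - xbar) \<le> norm (d t) * Y"
      using Cauchy_Schwarz_ineq2[of "d t" "x t - xbar"] by (simp add: Y_def)
    also have "\<dots> \<le> K * V * Y"
      using growth[OF t] by (auto simp: Y_def V_def intro: mult_right_mono)
    also have "\<dots> \<le> \<mu> / 2 * Y\<^sup>2 + K\<^sup>2 / (2 * \<mu>) * V\<^sup>2"
      using sum_squares_bound[of "\<mu> * Y" "K * V"] \<open>\<mu> > 0\<close>
      by (simp add: field_simps power2_eq_square)
    finally have force: "- inner (d t) (x t - xbar) \<le> \<mu> / 2 * Y\<^sup>2 + K\<^sup>2 / (2 * \<mu>) * V\<^sup>2" .
    have "f (x t) + inner (grad_f (x t)) (xbar - x t) + \<mu> / 2 * Y\<^sup>2 \<le> f xbar"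
      unfolding Y_def norm_minus_commute[of "x t"]
      by (rule strongly_convex_above_gradient_tangent[OF sc grad])
    then have "- inner (grad_f (x t)) (x t - xbar) \<le> - (f (x t) - f xbar) - \<mu> / 2 * Y\<^sup>2"
      by (simp add: inner_diff_right)
    with force have "inner (- d t - grad_f (x t)) (x t - xbar) + inner (v t) (v t)
        \<le> (1 + K\<^sup>2 / (2 * \<mu>)) * V\<^sup>2 - (f (x t) - f xbar)"
      by (simp add: inner_diff_left V_def power2_norm_eq_inner algebra_simps)
    also have "\<dots> = q * V\<^sup>2 - E t"
      by (simp add: q_def E_def mechanical_energy_def V_def algebra_simps)
    finally have "H' t \<le> - inner (d t) (v t) + \<epsilon> * (q * V\<^sup>2 - E t)"
      unfolding H'_def using \<epsilon> by (intro add_left_mono mult_left_mono) auto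
    also have "\<dots> = - inner (d t) (v t) + \<epsilon> * q * V\<^sup>2 - \<epsilon> * E t"
      by (simp add: algebra_simps)
    also have "\<dots> \<le> - \<epsilon> * E t"
      using coer[OF t] mult_right_mono[OF \<epsilon>1, of "V\<^sup>2"] by (simp add: V_def)
    finally show ?thesis .
  qed
  define \<kappa> where "\<kappa> = 2 * \<epsilon> / 3"
  have H_decay: "H t \<le> H t0 * exp (- \<kappa> * (t - t0))" if "t \<ge> t0" for t
  proof (rule exponential_decay_of_differential_inequality[OF _ _ that])
    fix s assume s: "s \<ge> t0"
    have xs: "((\<lambda>r. x r - xbar) has_vector_derivative v s) (at s)"
      using x[OF s] by (auto intro!: derivative_eq_intros)
    have "((\<lambda>r. inner (v r) (x r - xbar)) has_real_derivative
        inner (v s) (v s) + inner (- d s - grad_f (x s)) (x s - xbar)) (at s)"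
      unfolding has_real_derivative_iff_has_vector_derivative
      using bounded_bilinear.has_vector_derivative[OF bounded_bilinear_inner v[OF s] xs] by simp
    from DERIV_add[OF mechanical_energy_has_derivative[OF x[OF s] v[OF s] grad]
        DERIV_cmult[OF this, of \<epsilon>]]
    show "(H has_real_derivative H' s) (at s)"
      unfolding H_def[abs_def] H'_def E_def by (simp add: add.commute)
    have "H s \<le> 3 / 2 * E s"
      using H_near_E[of s] by linarith
    then have "\<kappa> * H s \<le> \<kappa> * (3 / 2 * E s)"
      using \<epsilon> by (intro mult_left_mono) (auto simp: \<kappa>_def)
    then show "H' s \<le> - \<kappa> * H s"
      using dissipation[OF s] by (simp add: \<kappa>_def)
  qed
  define C where "C = 2 * H t0 * exp (\<kappa> * t0) + 1"
  have "0 \<le> H t0"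
    using H_near_E[of t0] by linarith
  then have "C > 0"
    by (simp add: C_def add_nonneg_pos)
  moreover have "E t \<le> C * exp (- \<kappa> * t)" if "t \<ge> t0" for t
  proof -
    have "E t \<le> 2 * H t"
      using H_near_E[of t] by linarith
    also have "\<dots> \<le> 2 * (H t0 * exp (- \<kappa> * (t - t0)))"
      using H_decay[OF that] by simp
    also have "\<dots> = (C - 1) * exp (- \<kappa> * t)"
      by (simp add: C_def algebra_simps flip: exp_add)
    also have "\<dots> \<le> C * exp (- \<kappa> * t)"
      by simp
    finally show ?thesis .
  qed
  moreover have "\<kappa> > 0"
    using \<epsilon> by (simp add: \<kappa>_def)
  ultimately show ?thesis
    unfolding E_def by blast
qed

section \<open>Exponential convergence of trajectories\<close>

theorem theorem5p1:
  fixes f \<phi> :: "'a::{real_inner, complete_space} \<Rightarrow> real"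
    and grad_f grad_\<phi> :: "'a \<Rightarrow> 'a"
    and xbar :: 'a
    and x :: "real \<Rightarrow> 'a"
    and \<mu> \<alpha> \<rho> p c :: real
  assumes "\<And>y. GDERIV f y :> grad_f y"
    and "\<mu> > 0" and "strongly_convex \<mu> f"
    and "lipschitz_on_bounded grad_f"
    and "is_arg_min f (\<lambda>_. True) xbar"
    and "damping_potential \<phi>"
    and "\<And>u. GDERIV \<phi> u :> grad_\<phi> u"
    and "lipschitz_on_bounded grad_\<phi>"
    and "\<alpha> > 0" and "\<rho> > 0"
    and "\<And>u. norm u \<le> \<rho> \<Longrightarrow> inner (grad_\<phi> u) u \<ge> \<alpha> * (norm u)\<^sup>2"
    and "p \<ge> 1" and "c > 0"
    and "\<And>u. \<phi> u \<ge> c * norm u powr p"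
    and "solution_trajectory grad_\<phi> grad_f x"
  shows "exponential_rate_to_zero (\<lambda>t. f (x t) - f xbar) \<and>
    exponential_rate_to_zero (\<lambda>t. norm (x t - xbar)) \<and>
    exponential_rate_to_zero (\<lambda>t. norm (velocity x t))"
proof -
  note grad_f = assms(1) and grad_\<phi> = assms(7) and sol = assms(15)
  define v where "v = velocity x"
  define E where "E = mechanical_energy f xbar x v"
  have \<phi>: "convex_on UNIV \<phi>" "\<phi> 0 = 0" "is_arg_min \<phi> (\<lambda>_. True) 0" "\<And>u. 0 \<le> \<phi> u"
    using assms(6) by (auto simp: damping_potential_def)
  have zero: "grad_f xbar = 0" "grad_\<phi> 0 = 0"
    using GDERIV_at_minimum assms(5) \<phi>(3) grad_f grad_\<phi> by blast+
  have min: "0 \<le> f (x t) - f xbar" for t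
    using assms(5) by (simp add: is_arg_min_linorder)
  have x: "(x has_vector_derivative v t) (at t)" if "t \<ge> 1" for t
    using solution_trajectory_has_velocity[OF sol, of t] that by (simp add: v_def)
  have v: "(v has_vector_derivative - grad_\<phi> (v t) - grad_f (x t)) (at t)" if "t \<ge> 1" for t
    using solution_trajectory_classical[OF sol lipschitz_on_bounded_imp_continuous
        lipschitz_on_bounded_imp_continuous] assms(4,8) that by (simp add: v_def)
  have dissipative: "0 \<le> inner (grad_\<phi> u) u" for u
    using convex_on_above_gradient_tangent[OF \<phi>(1) grad_\<phi>[of u], of 0] \<phi>(2) \<phi>(4)[of u] by simp
  \<comment> \<open>The energy is nonincreasing, so the velocity stays in a ball, where the damping is coercive
    and grows at most linearly.\<close>
  define R where "R = sqrt (2 * E 1)"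
  have bound: "norm (v t) \<le> R" if "t \<ge> 1" for t
  proof -
    have "E t \<le> E 1"
      using mechanical_energy_has_derivative[OF x v grad_f] dissipative
      unfolding E_def by (intro DERIV_nonpos_imp_nonincreasing[OF that]) force
    then have "(norm (v t))\<^sup>2 \<le> 2 * E 1"
      using min[of t] by (simp add: E_def mechanical_energy_def)
    then show ?thesis
      unfolding R_def by (rule real_le_rsqrt)
  qed
  obtain \<beta> where \<beta>: "\<beta> > 0" "\<And>u. norm u \<le> R \<Longrightarrow> \<beta> * (norm u)\<^sup>2 \<le> inner (grad_\<phi> u) u"
    using damping_coercive_on_ball[OF \<phi>(1,2) grad_\<phi> assms(9-11) _ assms(13,14), of R] assms(12)
    by auto
  obtain K where K: "\<And>u. norm u \<le> R \<Longrightarrow> norm (grad_\<phi> u) \<le> K * norm u"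
    using lipschitz_on_bounded_zero_imp_linear_growth[OF assms(8) zero(2), of R] by blast
  have "\<exists>C>0. \<exists>\<kappa>>0. \<forall>t\<ge>1. E t \<le> C * exp (- \<kappa> * t)"
    unfolding E_def
    by (rule mechanical_energy_exponential_decay[OF grad_f assms(2,3) zero(1) \<beta>(1) x v])
      (use \<beta>(2) K bound in auto)
  then obtain C \<kappa> where C: "C > 0" "\<kappa> > 0" and decay: "\<And>t. t \<ge> 1 \<Longrightarrow> E t \<le> C * exp (- \<kappa> * t)"
    by blast
  have value_decay: "f (x t) - f xbar \<le> C * exp (- \<kappa> * t)" if "t \<ge> 1" for t
  proof -
    have "f (x t) - f xbar \<le> E t"
      by (simp add: E_def mechanical_energy_def)
    then show ?thesis
      using decay[OF that] by simp
  qed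
  have "exponential_rate_to_zero (\<lambda>t. f (x t) - f xbar)"
    unfolding exponential_rate_to_zero_def
    using min C value_decay eventually_at_top_linorder by blast
  moreover have "exponential_rate_to_zero (\<lambda>t. norm (x t - xbar))"
  proof (rule exponential_rate_to_zero_if_square)
    fix t :: real assume t: "t \<ge> 1"
    have "\<mu> / 2 * (norm (x t - xbar))\<^sup>2 \<le> f (x t) - f xbar"
      using strongly_convex_above_gradient_tangent[OF assms(3) grad_f, of xbar "x t"] zero(1)
      by simp
    also note value_decay[OF t]
    finally show "(norm (x t - xbar))\<^sup>2 \<le> 2 * C / \<mu> * exp (- \<kappa> * t)"
      using \<open>\<mu> > 0\<close> by (simp add: field_simps)
  qed (use C \<open>\<mu> > 0\<close> in auto)
  moreover have "exponential_rate_to_zero (\<lambda>t. norm (velocity x t))"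
  proof (rule exponential_rate_to_zero_if_square)
    fix t :: real assume t: "t \<ge> 1"
    have "(norm (v t))\<^sup>2 \<le> 2 * E t"
      using min[of t] by (simp add: E_def mechanical_energy_def)
    then show "(norm (velocity x t))\<^sup>2 \<le> 2 * C * exp (- \<kappa> * t)"
      using decay[OF t] by (simp add: v_def)
  qed (use C in auto)
  ultimately show ?thesis
    by blast
qed

end
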